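(* Let $K \subseteq \mathbb{R}^n$ be a proper cone given as $K = \{\mathbf{z} \in \mathbb{R}^n : M(\mathbf{z}) \succeq 0\}$ by a linear matrix pencil $M(\mathbf{z}) = \sum_{j=1}^n M_j z_j$ with symmetric $l \times l$ matrices. Let $H = \{\mathbf{x} \in \mathbb{R}^n : x_1 = 1\}$, and assume that $K \cap H$ is bounded and that $M_1$ is the identity matrix. Let $f \in \mathbb{R}[z_1,\dots,z_n]$. Let $N(\mathbf{z}) = \sum_{j=1}^n N_j z_j$ be the linear matrix pencil of a spectrahedral, conic set $\{\mathbf{z} \in \mathbb{R}^n : N(\mathbf{z}) \succeq 0\}$ contained in $\mathrm{cl}(\mathcal{I}(f)^{\mathsf{c}})$, and assume that $N_1$ is the identity matrix as well. Then there exists a constant $\nu > 0$ such that $g_\nu(z_1, \ldots, z_n) := f(z_1, \nu z_2, \ldots, \nu z_n)$ is $K$-stable and such that the $K$-stability of $g_\nu$ is certified by the system $$C = (C_{ij})_{i,j=1}^l \succeq 0, \qquad \nu N_p = \sum_{i,j=1}^l (M_p)_{ij} C_{ij} \quad \text{for all } p = 1, \ldots, n,$$ where the variable matrix $C$ is a block matrix with $l \times l$ blocks. As a consequence, $f$ is $\hat{K}$-stable with respect to $\hat{K} = \mathrm{cone}(\{1\} \times \nu (K \cap H))$, where the multiplication of $\nu$ with the set $K \cap H$ is done in the $(n-1)$-dimensional space with variables $\mathbf{z}' = (z_2, \ldots, z_n)$ and $\mathrm{cone}$ denotes the conic hull.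
   Context: A proper cone in $\mathbb{R}^n$ is a full-dimensional, closed, pointed convex cone. For $f \in \mathbb{C}[z_1,\dots,z_n]$ the imaginary projection is $\mathcal{I}(f) = \{(\mathrm{Im}(z_1),\dots,\mathrm{Im}(z_n)) : \mathbf{z} \in \mathbb{C}^n,\ f(\mathbf{z}) = 0\}$, $\mathcal{I}(f)^{\mathsf{c}}$ is its complement in $\mathbb{R}^n$, and $\mathrm{cl}$ denotes topological closure. The polynomial $f$ is $K$-stable if $f(\mathbf{z}) \neq 0$ whenever the imaginary part of $\mathbf{z}$ lies in the interior of $K$, i.e. if $\mathcal{I}(f) \cap \mathrm{int}\, K = \emptyset$. $X \succeq 0$ means that the symmetric or Hermitian matrix $X$ is positive semidefinite. $(M_p)_{ij}$ is the scalar $(i,j)$ entry of $M_p$. The blocks $C_{ij}$ have the same size as the matrices $N_p$. That the stability is certified by the system means that the system has a solution $C$. Explicitly, $\{1\} \times \nu(K\cap H) = \{(1, \nu x_2, \ldots, \nu x_n) : (1,x_2,\dots,x_n) \in K\}$.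
   Formalization: The system's equation at p = 1 is N_1 = sum (M_1)_ij C_ij, without the factor ν (as printed it is false in general), and it is additionally assumed that the interior of {N(z) ⪰ 0} lies in the complement of I(f), since containment in cl(I(f)^c) alone does not suffice. *)

theory Defs
  imports "HOL-Analysis.Analysis" "HOL-Library.Poly_Mapping"
begin

section \<open>Polynomials\<close>

text \<open>A polynomial in the variables \<open>z i\<close>, for \<open>i\<close> in the finite type \<open>'n\<close>, is a finitely
  supported function from exponent vectors to coefficients.\<close>

type_synonym ('n, 'a) poly_in = "('n \<Rightarrow>\<^sub>0 nat) \<Rightarrow>\<^sub>0 'a"

definition poly_eval :: "('n::finite, 'a::comm_semiring_1) poly_in \<Rightarrow> 'a ^ 'n \<Rightarrow> 'a" where
  "poly_eval f z =
    (\<Sum>m\<in>Poly_Mapping.keys f. Poly_Mapping.lookup f m * (\<Prod>i\<in>UNIV. z $ i ^ Poly_Mapping.lookup m i))"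

definition complexify :: "('n, real) poly_in \<Rightarrow> ('n, complex) poly_in" where
  "complexify f = Poly_Mapping.map complex_of_real f"

text \<open>Multiplication by \<open>\<nu>\<close> of all coordinates except the distinguished one, \<open>i1\<close>.\<close>

definition scale_tail :: "'n \<Rightarrow> 'a \<Rightarrow> 'a ^ 'n \<Rightarrow> ('a::times) ^ 'n" where
  "scale_tail i1 \<nu> z = (\<chi> i. if i = i1 then z $ i else \<nu> * z $ i)"

text \<open>The polynomial obtained from \<open>f\<close> by substituting \<open>\<nu> z i\<close> for \<open>z i\<close>, for all \<open>i \<noteq> i1\<close>
  (see \<open>poly_eval_poly_scale_tail\<close>).\<close>

definition poly_scale_tail :: "'n::finite \<Rightarrow> 'a::comm_semiring_1 \<Rightarrow> ('n, 'a) poly_in \<Rightarrow> ('n, 'a) poly_in" where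
  "poly_scale_tail i1 \<nu> f =
    (\<Sum>m\<in>Poly_Mapping.keys f.
      Poly_Mapping.single m (Poly_Mapping.lookup f m * (\<Prod>i\<in>UNIV - {i1}. \<nu> ^ Poly_Mapping.lookup m i)))"

lemma poly_eval_superset:
  assumes "finite A" "Poly_Mapping.keys f \<subseteq> A"
  shows "poly_eval f z =
    (\<Sum>m\<in>A. Poly_Mapping.lookup f m * (\<Prod>i\<in>UNIV. z $ i ^ Poly_Mapping.lookup m i))"
  unfolding poly_eval_def
  by (rule sum.mono_neutral_left) (use assms in \<open>auto simp: in_keys_iff\<close>)

lemma lookup_complexify [simp]:
  "Poly_Mapping.lookup (complexify f) m = complex_of_real (Poly_Mapping.lookup f m)"
  by (auto simp: complexify_def Poly_Mapping.map.rep_eq when_def)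

lemma poly_eval_complexify:
  "poly_eval (complexify f) (\<chi> i. complex_of_real (x $ i)) = complex_of_real (poly_eval f x)"
proof -
  have "Poly_Mapping.keys (complexify f) = Poly_Mapping.keys f"
    by (auto simp: in_keys_iff)
  then show ?thesis by (simp add: poly_eval_def)
qed

lemma lookup_poly_scale_tail:
  "Poly_Mapping.lookup (poly_scale_tail i1 \<nu> f) m =
    Poly_Mapping.lookup f m * (\<Prod>i\<in>UNIV - {i1}. \<nu> ^ Poly_Mapping.lookup m i)"
  by (auto simp: poly_scale_tail_def Poly_Mapping.lookup_sum Poly_Mapping.lookup_single when_def
        in_keys_iff)

lemma poly_eval_poly_scale_tail:
  "poly_eval (poly_scale_tail i1 \<nu> f) z = poly_eval f (scale_tail i1 \<nu> z)"
proof -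
  have sub: "Poly_Mapping.keys (poly_scale_tail i1 \<nu> f) \<subseteq> Poly_Mapping.keys f"
    by (auto simp: in_keys_iff lookup_poly_scale_tail)
  have mon: "(\<Prod>i\<in>UNIV - {i1}. \<nu> ^ Poly_Mapping.lookup m i) * (\<Prod>i\<in>UNIV. z $ i ^ Poly_Mapping.lookup m i)
      = (\<Prod>i\<in>UNIV. scale_tail i1 \<nu> z $ i ^ Poly_Mapping.lookup m i)" for m
  proof -
    have s: "(\<Prod>i\<in>UNIV. w i) = w i1 * (\<Prod>i\<in>UNIV - {i1}. w i)" for w
      by (rule prod.remove) auto
    have "(\<Prod>i\<in>UNIV - {i1}. \<nu> ^ Poly_Mapping.lookup m i) *
        (\<Prod>i\<in>UNIV - {i1}. z $ i ^ Poly_Mapping.lookup m i)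
      = (\<Prod>i\<in>UNIV - {i1}. scale_tail i1 \<nu> z $ i ^ Poly_Mapping.lookup m i)"
      unfolding prod.distrib[symmetric]
      by (rule prod.cong) (auto simp: scale_tail_def power_mult_distrib)
    then show ?thesis
      unfolding s by (simp add: scale_tail_def mult.left_commute)
  qed
  show ?thesis
    by (subst poly_eval_superset[OF finite_keys sub])
      (simp add: lookup_poly_scale_tail mult.assoc mon poly_eval_def)
qed


section \<open>Imaginary projections and conic stability\<close>

definition imag_proj :: "('n::finite, complex) poly_in \<Rightarrow> (real ^ 'n) set" where
  "imag_proj f = {(\<chi> i. Im (z $ i)) | z. poly_eval f z = 0}"

definition conic_stable :: "(real ^ 'n::finite) set \<Rightarrow> ('n, complex) poly_in \<Rightarrow> bool" where
  "conic_stable K f \<longleftrightarrow> (\<forall>z. (\<chi> i. Im (z $ i)) \<in> interior K \<longrightarrow> poly_eval f z \<noteq> 0)"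

lemma conic_stable_iff_imag_proj: "conic_stable K f \<longleftrightarrow> imag_proj f \<inter> interior K = {}"
  by (auto simp: conic_stable_def imag_proj_def)

text \<open>Pitfall: \<open>K \<subseteq> closure (- imag_proj f)\<close> does not imply that \<open>f\<close> is \<open>K\<close>-stable. For the
  polynomial \<open>f = z i\<close> the imaginary projection is the hyperplane \<open>{y. y $ i = 0}\<close>, so the closure
  of its complement is everything.\<close>

definition proper_cone :: "'a::euclidean_space set \<Rightarrow> bool" where
  "proper_cone K \<longleftrightarrow>
    convex_cone K \<and> closed K \<and> aff_dim K = int DIM('a) \<and> K \<inter> uminus ` K = {0}"


section \<open>Positive semidefinite matrices and linear pencils\<close>

definition symmetric :: "real ^ 'l ^ 'l \<Rightarrow> bool" where
  "symmetric A \<longleftrightarrow> transpose A = A"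

definition hermitian :: "complex ^ 'k ^ 'k \<Rightarrow> bool" where
  "hermitian A \<longleftrightarrow> (\<forall>i j. A $ j $ i = cnj (A $ i $ j))"

definition psd :: "real ^ 'l ^ 'l \<Rightarrow> bool" where
  "psd A \<longleftrightarrow> symmetric A \<and> (\<forall>x. 0 \<le> x \<bullet> (A *v x))"

text \<open>For a Hermitian matrix the quadratic form is real, so taking the real part loses nothing.\<close>

definition hpsd :: "complex ^ 'k ^ 'k \<Rightarrow> bool" where
  "hpsd A \<longleftrightarrow> hermitian A \<and>
    (\<forall>x :: complex ^ 'k. 0 \<le> Re (\<Sum>i\<in>UNIV. \<Sum>j\<in>UNIV. cnj (x $ i) * A $ i $ j * x $ j))"

definition real_entries :: "complex ^ 'k ^ 'm \<Rightarrow> bool" where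
  "real_entries A \<longleftrightarrow> (\<forall>i j. A $ i $ j \<in> \<real>)"

definition pencil :: "('n::finite \<Rightarrow> 'a::real_vector) \<Rightarrow> real ^ 'n \<Rightarrow> 'a" where
  "pencil M z = (\<Sum>j\<in>UNIV. z $ j *\<^sub>R M j)"

text \<open>A block matrix with blocks indexed by \<open>'l\<close> and entries within a block indexed by \<open>'k\<close>
  is a matrix indexed by \<open>'l \<times> 'k\<close>.\<close>

definition block :: "'a ^ ('l::finite \<times> 'k::finite) ^ ('l \<times> 'k) \<Rightarrow> 'l \<Rightarrow> 'l \<Rightarrow> 'a ^ 'k ^ 'k" where
  "block C i j = (\<chi> a b. C $ (i, a) $ (j, b))"

text \<open>Pitfall: the pencil \<open>z \<mapsto> pencil N (scale_tail i1 \<nu> z)\<close> belonging to \<open>poly_scale_tail i1 \<nu> f\<close>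
  has the coefficient \<open>N i1\<close> at \<open>i1\<close> and \<open>\<nu> *\<^sub>R N p\<close> at \<open>p \<noteq> i1\<close>. The factor \<open>\<nu>\<close> must be absent
  at \<open>i1\<close>: with it at all indices, it could be absorbed into the block matrix and the system
  would not depend on \<open>\<nu>\<close>.\<close>

lemma pencil_scale_tail:
  "pencil N (scale_tail i1 \<nu> z) = pencil (\<lambda>p. if p = i1 then N p else \<nu> *\<^sub>R N p) z"
  unfolding pencil_def by (rule sum.cong) (auto simp: scale_tail_def)

end

theory Submission
  imports Defs
begin

text \<open>Boundedness of \<open>K \<inter> H\<close> means that the span of the \<open>M p\<close> with \<open>p \<noteq> i1\<close> contains no nonzero
  positive semidefinite matrix, so separating it from the rank-one matrices gives a positive
  definite \<open>V\<close> orthogonal to it, with trace \<open>1\<close> after scaling. Pointedness of \<open>K\<close> makes the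
  \<open>M p\<close> linearly independent; let \<open>E p\<close> be a symmetric dual family. Then
  \<open>C = V \<otimes> I + \<nu> (\<Sum>p \<noteq> i1. E p \<otimes> N p)\<close> solves the linear equations for every \<open>\<nu>\<close>, and it is a
  small perturbation of the positive definite matrix \<open>V \<otimes> I\<close> if \<open>\<nu>\<close> is small. Since \<open>N i1\<close> is the
  identity, the \<open>i1\<close>-th unit vector is an interior point of \<open>{z. N(z) \<succeq> 0}\<close>; a small \<open>\<nu>\<close> shrinks
  the bounded slice \<open>K \<inter> H\<close> towards this vector and into that interior, which yields both
  stability claims directly, without deducing them from \<open>C\<close>.\<close>

section \<open>Complex quadratic forms and perturbation of positive definite matrices\<close>

definition re_form :: "complex ^ 'm ^ 'm \<Rightarrow> complex ^ 'm \<Rightarrow> real" where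
  "re_form A x = Re (\<Sum>i\<in>UNIV. \<Sum>j\<in>UNIV. cnj (x $ i) * A $ i $ j * x $ j)"

lemma hpsd_iff_re_form: "hpsd A \<longleftrightarrow> hermitian A \<and> (\<forall>x. 0 \<le> re_form A x)"
  by (simp add: hpsd_def re_form_def)

lemma re_form_add: "re_form (A + B) x = re_form A x + re_form B x"
  by (simp add: re_form_def algebra_simps sum.distrib)

lemma re_form_scaleR: "re_form (c *\<^sub>R A) x = c * re_form A x"
proof -
  have "cnj (x $ i) * (c *\<^sub>R A) $ i $ j * x $ j =
      of_real c * (cnj (x $ i) * A $ i $ j * x $ j)" for i j
    unfolding vector_scaleR_component by (simp add: scaleR_conv_of_real)
  then show ?thesis
    unfolding re_form_def by (simp flip: sum_distrib_left)
qed

lemma re_form_scaleR_vec: "re_form A (c *\<^sub>R x) = c\<^sup>2 * re_form A x"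
proof -
  have "cnj ((c *\<^sub>R x) $ i) * A $ i $ j * (c *\<^sub>R x) $ j =
      of_real (c\<^sup>2) * (cnj (x $ i) * A $ i $ j * x $ j)" for i j
    unfolding vector_scaleR_component by (simp add: scaleR_conv_of_real power2_eq_square)
  then show ?thesis
    unfolding re_form_def by (simp flip: sum_distrib_left of_real_power)
qed

lemma re_form_mat_1: "re_form (mat 1) x = (norm x)\<^sup>2"
proof -
  have "re_form (mat 1) x = Re (\<Sum>i\<in>UNIV. \<Sum>j\<in>UNIV. if j = i then cnj (x $ i) * x $ i else 0)"
    unfolding re_form_def
    by (intro arg_cong[where f = Re] sum.cong refl) (auto simp: mat_def)
  also have "\<dots> = (\<Sum>i\<in>UNIV. (norm (x $ i))\<^sup>2)"
    by (simp add: cmod_def power2_eq_square)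
  also have "\<dots> = (norm x)\<^sup>2"
    by (simp add: norm_vec_def L2_set_def sum_nonneg)
  finally show ?thesis .
qed

text \<open>Each summand of the double sum is bounded separately, hence the factor
  \<open>CARD('m)\<close> squared. For \<open>hpsd_perturb\<close> any constant depending only on
  the size is enough.\<close>

lemma abs_re_form_le:
  fixes A :: "complex ^ 'm::finite ^ 'm"
  shows "\<bar>re_form A x\<bar> \<le> (real CARD('m))\<^sup>2 * norm A * (norm x)\<^sup>2"
proof -
  have "\<bar>re_form A x\<bar> \<le> norm (\<Sum>i\<in>UNIV. \<Sum>j\<in>UNIV. cnj (x $ i) * A $ i $ j * x $ j)"
    unfolding re_form_def by (rule abs_Re_le_cmod)
  also have "\<dots> \<le> (\<Sum>i\<in>(UNIV::'m set). \<Sum>j\<in>(UNIV::'m set). norm A * (norm x)\<^sup>2)"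
  proof (intro sum_norm_le)
    fix i j
    have "norm (A $ i $ j) \<le> norm A"
      by (rule order_trans[OF Finite_Cartesian_Product.norm_nth_le Finite_Cartesian_Product.norm_nth_le])
    then have "norm (x $ i) * norm (A $ i $ j) * norm (x $ j) \<le> norm x * norm A * norm x"
      by (intro mult_mono Finite_Cartesian_Product.norm_nth_le) auto
    then show "norm (cnj (x $ i) * A $ i $ j * x $ j) \<le> norm A * (norm x)\<^sup>2"
      by (simp add: norm_mult power2_eq_square mult_ac)
  qed
  also have "\<dots> = (real CARD('m))\<^sup>2 * norm A * (norm x)\<^sup>2"
    by (simp add: power2_eq_square)
  finally show ?thesis .
qed

lemma continuous_on_re_form: "continuous_on S (re_form A)"
  unfolding re_form_def by (intro continuous_intros)

lemma hermitian_iff_cnj: "hermitian A \<longleftrightarrow> (\<forall>i j. cnj (A $ i $ j) = A $ j $ i)"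
  unfolding hermitian_def by metis

lemma hermitian_add: "hermitian A \<Longrightarrow> hermitian B \<Longrightarrow> hermitian (A + B)"
  by (simp add: hermitian_iff_cnj)

lemma hermitian_scaleR: "hermitian A \<Longrightarrow> hermitian (c *\<^sub>R A)"
  by (simp add: hermitian_iff_cnj)

lemma hermitian_sum: "(\<And>i. i \<in> S \<Longrightarrow> hermitian (A i)) \<Longrightarrow> hermitian (\<Sum>i\<in>S. A i)"
  by (simp add: hermitian_iff_cnj)

text \<open>By compactness the form of \<open>A\<close> attains a positive minimum on the unit
  sphere, and by homogeneity this minimum times the squared norm bounds the form from below. A small
  Hermitian \<open>D\<close> cannot outweigh that bound.\<close>

lemma hpsd_perturb:
  fixes A :: "complex ^ 'm::finite ^ 'm"
  assumes "hermitian A" and pos: "\<And>x. x \<noteq> 0 \<Longrightarrow> 0 < re_form A x"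
  obtains r where "r > 0" "\<And>D. hermitian D \<Longrightarrow> norm D < r \<Longrightarrow> hpsd (A + D)"
proof -
  \<comment> \<open>\<open>undefined\<close> is just some index; any unit vector shows that the
    sphere is nonempty.\<close>
  have "axis undefined 1 \<in> sphere (0 :: complex ^ 'm) 1" by simp
  then have "sphere (0 :: complex ^ 'm) 1 \<noteq> {}" by blast
  with continuous_attains_inf[OF compact_sphere this continuous_on_re_form]
  obtain x0 where x0: "x0 \<in> sphere 0 1" "\<And>x. x \<in> sphere 0 1 \<Longrightarrow> re_form A x0 \<le> re_form A x"
    by blast
  let ?c = "re_form A x0" and ?n = "(real CARD('m))\<^sup>2"
  have c: "?c > 0" using x0(1) by (intro pos) auto
  have n: "?n > 0" by simp
  have le: "?c * (norm x)\<^sup>2 \<le> re_form A x" for x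
  proof (cases "x = 0")
    case False
    have "(1 / norm x) *\<^sub>R x \<in> sphere 0 1" using False by simp
    from x0(2)[OF this] False show ?thesis
      unfolding re_form_scaleR_vec by (simp add: power_divide pos_le_divide_eq)
  qed (simp add: re_form_def)
  show thesis
  proof
    show "?c / ?n > 0" using c n by simp
    fix D :: "complex ^ 'm ^ 'm" assume D: "hermitian D" "norm D < ?c / ?n"
    have "0 \<le> re_form (A + D) x" for x
    proof -
      have "?n * norm D \<le> ?c" using D(2) by (simp add: pos_less_divide_eq mult.commute)
      then have "?n * norm D * (norm x)\<^sup>2 \<le> ?c * (norm x)\<^sup>2" by (intro mult_right_mono) auto
      with abs_re_form_le[of D x] le[of x] show ?thesis by (simp add: re_form_add)
    qed
    with assms(1) D(1) show "hpsd (A + D)" by (simp add: hpsd_iff_re_form hermitian_add)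
  qed
qed

section \<open>Kronecker products and contraction of block matrices\<close>

definition kron :: "real ^ 'l ^ 'l \<Rightarrow> complex ^ 'k ^ 'k \<Rightarrow> complex ^ ('l \<times> 'k) ^ ('l \<times> 'k)" where
  "kron A X = (\<chi> s t. (A $ fst s $ fst t) *\<^sub>R X $ snd s $ snd t)"

lemma symmetric_nth: "symmetric A \<Longrightarrow> A $ j $ i = A $ i $ j"
  by (simp add: symmetric_def transpose_def vec_eq_iff)

lemma hermitian_kron: "symmetric A \<Longrightarrow> hermitian X \<Longrightarrow> hermitian (kron A X)"
  unfolding hermitian_iff_cnj by (simp add: kron_def symmetric_nth scaleR_conv_of_real)

lemma real_entries_kron: "real_entries X \<Longrightarrow> real_entries (kron A X)"
  unfolding real_entries_def kron_def by (auto simp: scaleR_conv_of_real)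

lemma real_entries_add: "real_entries A \<Longrightarrow> real_entries B \<Longrightarrow> real_entries (A + B)"
  by (simp add: real_entries_def)

lemma real_entries_scaleR: "real_entries A \<Longrightarrow> real_entries (c *\<^sub>R A)"
  unfolding real_entries_def vector_scaleR_component by (simp add: scaleR_conv_of_real)

lemma real_entries_sum: "(\<And>i. i \<in> S \<Longrightarrow> real_entries (A i)) \<Longrightarrow> real_entries (\<Sum>i\<in>S. A i)"
  by (simp add: real_entries_def sum_in_Reals)

lemma inner_matrix: "A \<bullet> B = (\<Sum>i\<in>UNIV. \<Sum>j\<in>UNIV. A $ i $ j * B $ i $ j)"
  for A B :: "real ^ 'l::finite ^ 'm::finite"
  by (simp add: inner_vec_def)

text \<open>This is the right-hand side of the system, seen as a map of the block matrix: a partial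
  trace that sums out the block indices against \<open>A\<close>.\<close>

definition block_contract ::
  "real ^ 'l::finite ^ 'l \<Rightarrow> complex ^ ('l \<times> 'k::finite) ^ ('l \<times> 'k) \<Rightarrow> complex ^ 'k ^ 'k" where
  "block_contract A C = (\<Sum>i\<in>UNIV. \<Sum>j\<in>UNIV. (A $ i $ j) *\<^sub>R block C i j)"

text \<open>Contraction touches only the first tensor factor. On sums of Kronecker products, the
  system thus becomes a set of inner product conditions on real matrices.\<close>

lemma block_contract_kron: "block_contract A (kron B X) = (A \<bullet> B) *\<^sub>R X"
  by (simp add: block_contract_def vec_eq_iff block_def kron_def inner_matrix sum_distrib_right
      scaleR_sum_left mult.assoc)

lemma linear_block_contract: "linear (block_contract A)"
  by (rule linearI)
    (simp_all add: block_contract_def vec_eq_iff block_def algebra_simps sum.distrib scaleR_sum_right)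

lemma inner_mult_vec: "u \<bullet> (A *v u) = (\<Sum>i\<in>UNIV. \<Sum>j\<in>UNIV. u $ i * A $ i $ j * u $ j)"
  for A :: "real ^ 'l::finite ^ 'l"
  by (simp add: inner_vec_def matrix_vector_mult_def sum_distrib_left mult.assoc)

lemma sum_UNIV_prod: "(\<Sum>p\<in>UNIV. g p) = (\<Sum>i\<in>UNIV. \<Sum>a\<in>UNIV. g (i, a))"
  for g :: "'a::finite \<times> 'b::finite \<Rightarrow> 'c::comm_monoid_add"
  unfolding sum.cartesian_product by simp

text \<open>With identity blocks, the components of \<open>x\<close> with different inner index
  \<open>a\<close> do not interact. As \<open>A\<close> is real, the cross terms between real and
  imaginary parts are purely imaginary and drop out.\<close>

lemma re_form_kron_mat_1:
  fixes A :: "real ^ 'l::finite ^ 'l" and x :: "complex ^ ('l \<times> 'k::finite)"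
  defines "u \<equiv> \<lambda>a. \<chi> i. Re (x $ (i, a))" and "v \<equiv> \<lambda>a. \<chi> i. Im (x $ (i, a))"
  shows "re_form (kron A (mat 1)) x = (\<Sum>a\<in>UNIV. u a \<bullet> (A *v u a) + v a \<bullet> (A *v v a))"
proof -
  have "re_form (kron A (mat 1)) x =
    Re (\<Sum>i\<in>UNIV. \<Sum>a\<in>UNIV. \<Sum>j\<in>UNIV. \<Sum>b\<in>UNIV.
      if b = a then cnj (x $ (i, a)) * of_real (A $ i $ j) * x $ (j, a) else 0)"
    unfolding re_form_def sum_UNIV_prod
    by (intro arg_cong[where f = Re] sum.cong refl)
      (auto simp: kron_def mat_def scaleR_conv_of_real)
  also have "\<dots> = (\<Sum>i\<in>UNIV. \<Sum>a\<in>UNIV. \<Sum>j\<in>UNIV.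
      u a $ i * A $ i $ j * u a $ j + v a $ i * A $ i $ j * v a $ j)"
    by (simp add: u_def v_def)
  also have "\<dots> = (\<Sum>a\<in>UNIV. u a \<bullet> (A *v u a) + v a \<bullet> (A *v v a))"
    by (subst sum.swap) (simp add: inner_mult_vec sum.distrib)
  finally show ?thesis .
qed

lemma re_form_kron_mat_1_pos:
  fixes A :: "real ^ 'l::finite ^ 'l" and x :: "complex ^ ('l \<times> 'k::finite)"
  assumes pos: "\<And>u. u \<noteq> 0 \<Longrightarrow> 0 < u \<bullet> (A *v u)" and "x \<noteq> 0"
  shows "0 < re_form (kron A (mat 1)) x"
proof -
  let ?u = "\<lambda>a. \<chi> i. Re (x $ (i, a))" and ?v = "\<lambda>a. \<chi> i. Im (x $ (i, a))"
  from \<open>x \<noteq> 0\<close> obtain i a where ia: "x $ (i, a) \<noteq> 0" by (auto simp: vec_eq_iff)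
  have nonneg: "0 \<le> u \<bullet> (A *v u)" for u
    using pos[of u] by (cases "u = 0") auto
  have "?u a \<noteq> 0 \<or> ?v a \<noteq> 0"
    using ia by (auto simp: vec_eq_iff complex_eq_iff)
  then have "0 < ?u a \<bullet> (A *v ?u a) + ?v a \<bullet> (A *v ?v a)"
    using pos nonneg by (meson add_nonneg_pos add_pos_nonneg)
  then show ?thesis
    unfolding re_form_kron_mat_1 by (intro sum_pos2[of _ a]) (auto intro: add_nonneg_nonneg nonneg)
qed

section \<open>Symmetric matrices and separation from the positive semidefinite cone\<close>

definition sym_part :: "real ^ 'l ^ 'l \<Rightarrow> real ^ 'l ^ 'l" where
  "sym_part A = (1 / 2) *\<^sub>R (A + transpose A)"

lemma symmetric_sym_part: "symmetric (sym_part A)"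
  by (simp add: symmetric_def sym_part_def transpose_def vec_eq_iff)

text \<open>Transposing both arguments preserves the inner product and fixes \<open>A\<close>.
  Matrices found by separation or duality can therefore be symmetrized without changing their
  pairings with the \<open>M p\<close>.\<close>

lemma inner_sym_part:
  fixes A B :: "real ^ 'l::finite ^ 'l"
  assumes "symmetric A"
  shows "A \<bullet> sym_part B = A \<bullet> B"
proof -
  have "A \<bullet> transpose B = (\<Sum>i\<in>UNIV. \<Sum>j\<in>UNIV. A $ j $ i * B $ j $ i)"
    by (simp add: inner_matrix transpose_def symmetric_nth[OF assms])
  also have "\<dots> = A \<bullet> B" by (subst sum.swap) (simp add: inner_matrix)
  finally show ?thesis by (simp add: sym_part_def inner_add_right)
qed

definition rank_one :: "real ^ 'l \<Rightarrow> real ^ 'l ^ 'l" where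
  "rank_one u = (\<chi> i j. u $ i * u $ j)"

lemma symmetric_rank_one: "symmetric (rank_one u)"
  by (simp add: symmetric_def rank_one_def transpose_def vec_eq_iff)

lemma inner_rank_one: "rank_one u \<bullet> A = u \<bullet> (A *v u)"
  for A :: "real ^ 'l::finite ^ 'l"
  by (simp add: inner_mult_vec inner_matrix rank_one_def mult_ac)

lemma symmetric_add: "symmetric A \<Longrightarrow> symmetric B \<Longrightarrow> symmetric (A + B)"
  by (simp add: symmetric_def transpose_def vec_eq_iff)

lemma symmetric_scaleR: "symmetric A \<Longrightarrow> symmetric (c *\<^sub>R A)"
  by (simp add: symmetric_def transpose_def vec_eq_iff)

lemma psd_add: "psd A \<Longrightarrow> psd B \<Longrightarrow> psd (A + B)"
  for A B :: "real ^ 'l::finite ^ 'l"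
  by (simp add: psd_def symmetric_add matrix_vector_mult_add_rdistrib inner_add_right)

lemma psd_scaleR: "psd A \<Longrightarrow> 0 \<le> c \<Longrightarrow> psd (c *\<^sub>R A)"
  for A :: "real ^ 'l::finite ^ 'l"
  by (simp add: psd_def symmetric_scaleR flip: scaleR_matrix_vector_assoc)

lemma psd_rank_one: "psd (rank_one u)"
  for u :: "real ^ 'l::finite"
proof -
  have "x \<bullet> (rank_one u *v x) = (u \<bullet> x)\<^sup>2" for x
    unfolding inner_mult_vec
    by (simp add: rank_one_def inner_vec_def power2_eq_square sum_product mult_ac)
  then show ?thesis by (simp add: psd_def symmetric_rank_one)
qed

lemma inner_mat_1_rank_one: "mat 1 \<bullet> rank_one u = (norm u)\<^sup>2"
  for u :: "real ^ 'l::finite"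
  by (subst inner_commute) (simp add: inner_rank_one power2_norm_eq_inner)

text \<open>Strict separation of \<open>L\<close> from the compact hull of the normalized rank-one
  matrices gives \<open>W\<close>. A linear functional bounded above on a subspace vanishes there,
  and positivity on the rank-one matrices is positive definiteness.\<close>

lemma subspace_meets_psd_trivially_imp_orthogonal_pd:
  fixes L :: "(real ^ 'l::finite ^ 'l) set"
  assumes L: "subspace L" and triv: "\<And>A. A \<in> L \<Longrightarrow> psd A \<Longrightarrow> A = 0"
  obtains W where "\<And>A. A \<in> L \<Longrightarrow> A \<bullet> W = 0" "\<And>u. u \<noteq> 0 \<Longrightarrow> 0 < u \<bullet> (W *v u)"
proof -
  let ?T = "rank_one ` sphere (0 :: real ^ 'l) 1"
  let ?S = "convex hull ?T"
  have "continuous_on (sphere 0 1) (rank_one :: real ^ 'l \<Rightarrow> _)"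
    unfolding rank_one_def by (intro continuous_intros)
  then have comp: "compact ?S"
    by (intro compact_convex_hull compact_continuous_image compact_sphere)
  have "axis undefined 1 \<in> sphere (0 :: real ^ 'l) 1" by simp
  then have ne: "?S \<noteq> {}" by (metis convex_hull_eq_empty empty_iff image_is_empty)
  have "?S \<subseteq> {A. psd A \<and> mat 1 \<bullet> A = 1}"
    by (rule hull_minimal)
      (auto simp: psd_rank_one inner_mat_1_rank_one convex_def inner_add_right
        intro: psd_add psd_scaleR)
  \<comment> \<open>Every element of the hull has trace 1, so it is not the zero matrix.\<close>
  then have "L \<inter> ?S = {}" using triv by fastforce
  then obtain W b where Wb: "\<forall>A\<in>L. W \<bullet> A < b" "\<forall>A\<in>?S. b < W \<bullet> A"
    using separating_hyperplane_closed_compact[of L ?S] subspace_imp_convex[OF L]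
      closed_subspace[OF L] comp ne convex_convex_hull by metis
  have b: "b > 0" using Wb(1) subspace_0[OF L] by force
  have orth: "A \<bullet> W = 0" if "A \<in> L" for A
  proof (rule ccontr)
    assume "A \<bullet> W \<noteq> 0"
    \<comment> \<open>On this multiple of \<open>A\<close> the functional would take exactly the
      value \<open>b\<close>.\<close>
    moreover from Wb(1) L that have "W \<bullet> ((b / (A \<bullet> W)) *\<^sub>R A) < b"
      using subspace_scale by blast
    ultimately show False by (simp add: inner_commute)
  qed
  have "0 < u \<bullet> (W *v u)" if "u \<noteq> 0" for u
  proof -
    let ?w = "(1 / norm u) *\<^sub>R u"
    have "rank_one ?w \<in> ?S" using that by (intro hull_inc imageI) simp
    then have "0 < ?w \<bullet> (W *v ?w)"
      using Wb(2) b inner_rank_one[of ?w W] by (force simp: inner_commute)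
    then show ?thesis
      using that by (simp add: matrix_vector_mult_scaleR zero_less_mult_iff zero_less_divide_iff)
  qed
  with orth show thesis using that by blast
qed

section \<open>Linear pencils and dual families\<close>

lemma linear_pencil: "linear (pencil M)"
  by (rule linearI) (simp_all add: pencil_def scaleR_left_distrib sum.distrib scaleR_sum_right)

lemma pencil_axis: "pencil M (axis p 1) = M p"
proof -
  have "pencil M (axis p 1) = (\<Sum>j\<in>UNIV. if j = p then M j else 0)"
    unfolding pencil_def by (intro sum.cong) (auto simp: axis_def)
  then show ?thesis by simp
qed

text \<open>A linear left inverse of the pencil sends \<open>M q\<close> to the \<open>q\<close>-th
  unit vector; its adjoint sends the unit vectors to a dual family.\<close>

lemma inj_pencil_imp_dual_family:
  fixes M :: "'n::finite \<Rightarrow> 'a::euclidean_space"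
  assumes "inj (pencil M)"
  obtains B where "\<And>p q. M q \<bullet> B p = (if p = q then 1 else 0)"
proof -
  obtain g where g: "linear g" "g \<circ> pencil M = id"
    using linear_injective_left_inverse[OF linear_pencil assms] by blast
  have "M q \<bullet> adjoint g (axis p 1) = (if p = q then 1 else 0)" for p q
  proof -
    have "g (M q) = axis q 1"
      using fun_cong[OF g(2), of "axis q 1"] by (simp add: pencil_axis)
    then show ?thesis
      using adjoint_works[OF g(1), of "M q" "axis p 1"]
      by (simp add: inner_axis) (auto simp: axis_def)
  qed
  then show thesis by (rule that)
qed

section \<open>Rescaled polynomials and the interior of a spectrahedral cone\<close>

lemma scale_tail_scaleR: "scale_tail i1 \<nu> (c *\<^sub>R x) = c *\<^sub>R scale_tail i1 \<nu> x"
  for x :: "real ^ 'n"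
  by (simp add: scale_tail_def vec_eq_iff)

lemma complexify_poly_scale_tail:
  "complexify (poly_scale_tail i1 \<nu> f) = poly_scale_tail i1 (of_real \<nu>) (complexify f)"
  by (rule poly_mapping_eqI) (simp add: lookup_poly_scale_tail)

text \<open>Since \<nu> is real, scaling commutes with taking imaginary parts, so a zero of the
  rescaled polynomial yields a zero of \<open>f\<close> with scaled imaginary part.\<close>

lemma conic_stable_poly_scale_tail:
  assumes "\<And>y. y \<in> interior K \<Longrightarrow> scale_tail i1 \<nu> y \<notin> imag_proj (complexify f)"
  shows "conic_stable K (complexify (poly_scale_tail i1 \<nu> f))"
  unfolding conic_stable_def
proof (intro allI impI notI)
  fix z :: "complex ^ 'a"
  assume z: "(\<chi> i. Im (z $ i)) \<in> interior K"
    "poly_eval (complexify (poly_scale_tail i1 \<nu> f)) z = 0"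
  have "(\<chi> i. Im (scale_tail i1 (of_real \<nu>) z $ i)) = scale_tail i1 \<nu> (\<chi> i. Im (z $ i))"
    by (simp add: scale_tail_def vec_eq_iff)
  moreover have "poly_eval (complexify f) (scale_tail i1 (of_real \<nu>) z) = 0"
    using z(2) by (simp add: complexify_poly_scale_tail poly_eval_poly_scale_tail)
  ultimately show False using assms[OF z(1)] unfolding imag_proj_def by auto
qed

lemma hpsd_scaleR: "hpsd A \<Longrightarrow> 0 \<le> c \<Longrightarrow> hpsd (c *\<^sub>R A)"
  by (simp add: hpsd_iff_re_form hermitian_scaleR re_form_scaleR)

lemma scaleR_interior_hpsd_pencil:
  assumes "y \<in> interior {z. hpsd (pencil N z)}" "c > 0"
  shows "c *\<^sub>R y \<in> interior {z. hpsd (pencil N z)}"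
proof -
  have "((*\<^sub>R) c) ` interior {z. hpsd (pencil N z)} \<subseteq> {z. hpsd (pencil N z)}"
    using interior_subset[of "{z. hpsd (pencil N z)}"] assms(2)
    by (auto simp: linear_scale[OF linear_pencil] intro!: hpsd_scaleR)
  moreover have "open (((*\<^sub>R) c) ` interior {z. hpsd (pencil N z)})"
    using assms(2) by (intro open_scaling) auto
  ultimately show ?thesis using assms(1) by (blast intro: interiorI)
qed

text \<open>The pencil takes the positive definite value \<open>mat 1\<close> at this vector; by
  continuity, nearby values are small Hermitian perturbations of it, to which
  \<open>hpsd_perturb\<close> applies.\<close>

lemma axis_in_interior_hpsd_pencil:
  fixes N :: "'n::finite \<Rightarrow> complex ^ 'k::finite ^ 'k"
  assumes "\<And>p. hermitian (N p)" "N i = mat 1"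
  shows "axis i 1 \<in> interior {z. hpsd (pencil N z)}"
proof -
  have "hermitian (mat 1 :: complex ^ 'k ^ 'k)" using assms by metis
  then obtain r where r: "r > 0" "\<And>D. hermitian D \<Longrightarrow> norm D < r \<Longrightarrow> hpsd (mat 1 + D :: complex ^ 'k ^ 'k)"
    by (rule hpsd_perturb) (auto simp: re_form_mat_1)
  have herm: "hermitian (pencil N z)" for z
    unfolding pencil_def by (intro hermitian_sum hermitian_scaleR assms)
  let ?U = "{z. norm (pencil N (z - axis i 1)) < r}"
  have "open ?U"
    by (intro open_Collect_less continuous_on_norm continuous_on_const
        linear_continuous_on_compose[OF _ linear_pencil] continuous_on_diff continuous_on_id)
  moreover have "?U \<subseteq> {z. hpsd (pencil N z)}"
  proof clarify
    fix z assume "norm (pencil N (z - axis i 1)) < r"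
    from r(2)[OF herm this] show "hpsd (pencil N z)"
      using assms(2) by (simp add: linear_diff[OF linear_pencil] pencil_axis)
  qed
  moreover have "axis i 1 \<in> ?U"
    using r(1) by (simp add: linear_0[OF linear_pencil])
  ultimately show ?thesis by (blast intro: interiorI)
qed

text \<open>The index \<open>i1\<close> plays the role of the first variable, and its equation
  carries no \<nu> because the substitution leaves that variable alone. \<open>N_interior\<close>
  keeps the imaginary projection, for instance a hyperplane, from crossing the interior of the
  spectrahedral cone, which containment in the closure would allow. The clause on
  \<open>real_entries\<close> covers real symmetric \<open>N p\<close>.\<close>

theorem theorem5p2:
  fixes i1 :: "'n::finite"
    and K :: "(real ^ 'n) set"
    and M :: "'n \<Rightarrow> real ^ 'l::finite ^ 'l"
    and N :: "'n \<Rightarrow> complex ^ 'k::finite ^ 'k"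
    and f :: "('n, real) poly_in"
  defines "H \<equiv> {x :: real ^ 'n. x $ i1 = 1}"
  assumes K_proper: "proper_cone K"
    and M_sym: "\<And>p. symmetric (M p)"
    and K_eq: "K = {z. psd (pencil M z)}"
    and bounded: "bounded (K \<inter> H)"
    and M_one: "M i1 = mat 1"
    and N_herm: "\<And>p. hermitian (N p)"
    and N_closure: "{z. hpsd (pencil N z)} \<subseteq> closure (- imag_proj (complexify f))"
    and N_interior: "interior {z. hpsd (pencil N z)} \<subseteq> - imag_proj (complexify f)"
    and N_one: "N i1 = mat 1"
  shows "\<exists>\<nu>>0.
      conic_stable K (complexify (poly_scale_tail i1 \<nu> f)) \<and>
      (\<exists>C :: complex ^ ('l \<times> 'k) ^ ('l \<times> 'k).
          hpsd C \<and>
          N i1 = (\<Sum>i\<in>UNIV. \<Sum>j\<in>UNIV. (M i1 $ i $ j) *\<^sub>R block C i j) \<and>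
          (\<forall>p. p \<noteq> i1 \<longrightarrow>
            \<nu> *\<^sub>R N p = (\<Sum>i\<in>UNIV. \<Sum>j\<in>UNIV. (M p $ i $ j) *\<^sub>R block C i j)) \<and>
          ((\<forall>p. real_entries (N p)) \<longrightarrow> real_entries C)) \<and>
      conic_stable (conic hull (scale_tail i1 \<nu> ` (K \<inter> H))) (complexify f)"
proof -
  let ?e = "axis i1 1 :: real ^ 'n"
  let ?P = "{z. hpsd (pencil N z)}"
  have pointed: "z = 0" if "z \<in> K" "- z \<in> K" for z
    using K_proper that unfolding proper_cone_def
    by (metis IntI empty_iff imageI insert_iff minus_minus)
  have K_add: "x + y \<in> K" if "x \<in> K" "y \<in> K" for x y
    using that by (simp add: K_eq linear_add[OF linear_pencil] psd_add)
  have K_scale: "c *\<^sub>R x \<in> K" if "x \<in> K" "c \<ge> 0" for x c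
    using that by (simp add: K_eq linear_scale[OF linear_pencil] psd_scaleR)
  have e_K: "?e \<in> K"
    using M_sym[of i1] by (simp add: K_eq pencil_axis M_one psd_def)
  \<comment> \<open>Such a \<open>z\<close> would be a recession direction of the bounded slice,
    based at the point \<open>?e\<close>.\<close>
  have K_coord_0: "z = 0" if z: "z \<in> K" "z $ i1 = 0" for z
  proof (rule ccontr)
    assume "z \<noteq> 0"
    obtain R where R: "\<And>x. x \<in> K \<inter> H \<Longrightarrow> norm x \<le> R"
      using bounded by (auto simp: bounded_iff)
    \<comment> \<open>Chosen so that \<open>?t *\<^sub>R z\<close> has norm
      \<open>\<bar>R\<bar> + 2\<close>, more than the \<open>R + 1\<close> that the triangle
      inequality permits.\<close>
    let ?t = "(\<bar>R\<bar> + 2) / norm z"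
    have "?e + ?t *\<^sub>R z \<in> K \<inter> H"
      using z by (auto intro!: K_add K_scale e_K simp: H_def)
    then have "norm (?e + ?t *\<^sub>R z) \<le> R" by (rule R)
    moreover have "norm (?t *\<^sub>R z) \<le> norm (?e + ?t *\<^sub>R z) + norm ?e"
      by (metis add_diff_cancel_left' norm_triangle_ineq4 add.commute)
    moreover have "norm (?t *\<^sub>R z) = \<bar>R\<bar> + 2" using \<open>z \<noteq> 0\<close> by simp
    ultimately show False by simp
  qed
  have K_coord_pos: "z $ i1 > 0" if z: "z \<in> K" "z \<noteq> 0" for z
  proof (rule ccontr)
    assume "\<not> z $ i1 > 0"
    with K_coord_0 z have neg: "z $ i1 < 0" by fastforce
    \<comment> \<open>Adding a positive multiple of \<open>?e\<close> cancels the negative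
      coordinate; then \<open>z\<close> is a negative multiple of \<open>?e\<close>, against
      pointedness.\<close>
    then have "z + (- (z $ i1)) *\<^sub>R ?e \<in> K" by (intro K_add K_scale z e_K) auto
    then have "z + (- (z $ i1)) *\<^sub>R ?e = 0" by (rule K_coord_0) simp
    then have "z = (z $ i1) *\<^sub>R ?e" by simp
    then have "- z \<in> K"
      using K_scale[OF e_K, of "- (z $ i1)"] neg
      by (metis neg_0_le_iff_le less_imp_le scaleR_minus_left)
    with pointed z show False by blast
  qed

  \<comment> \<open>If \<open>z\<close> is in the kernel, then \<open>z\<close> and
    \<open>- z\<close> both lie in \<open>K\<close>, as the zero matrix is
    \<open>psd\<close>.\<close>
  have "inj (pencil M)"
    unfolding linear_injective_0[OF linear_pencil]
  proof (intro allI impI)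
    fix z assume "pencil M z = 0"
    moreover have "psd (0 :: real ^ 'l ^ 'l)"
      using psd_scaleR[OF psd_rank_one order_refl] by simp
    ultimately show "z = 0"
      by (intro pointed) (simp_all add: K_eq linear_neg[OF linear_pencil])
  qed
  then obtain B where B: "\<And>p q. M q \<bullet> B p = (if p = q then 1 else 0)"
    by (rule inj_pencil_imp_dual_family) blast
  let ?L = "pencil M ` {z. z $ i1 = 0}"
  have L: "subspace ?L"
    by (intro linear_subspace_image linear_pencil) (auto simp: subspace_def)
  obtain W where W: "\<And>A. A \<in> ?L \<Longrightarrow> A \<bullet> W = 0" "\<And>u. u \<noteq> 0 \<Longrightarrow> 0 < u \<bullet> (W *v u)"
  proof (rule subspace_meets_psd_trivially_imp_orthogonal_pd[OF L])
    fix A assume "A \<in> ?L" "psd A"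
    then obtain z where "A = pencil M z" "z $ i1 = 0" "z \<in> K" by (auto simp: K_eq)
    then show "A = 0" using K_coord_0[of z] by (simp add: linear_0[OF linear_pencil])
  qed blast
  have W_M: "M p \<bullet> W = 0" if "p \<noteq> i1" for p
    using that by (intro W(1) image_eqI[where x = "axis p 1"]) (simp add: pencil_axis, simp add: axis_def)
  \<comment> \<open>As \<open>M i1\<close> is the identity, this is the trace of
    \<open>W\<close>.\<close>
  let ?tr = "M i1 \<bullet> W"
  have tr: "?tr > 0"
  proof -
    have "?tr = (\<Sum>i\<in>UNIV. axis i 1 \<bullet> (W *v axis i 1))"
      by (simp add: M_one inner_matrix mat_def inner_axis' matrix_vector_mul_component inner_axis
          if_distrib[of "\<lambda>x. x * _"] cong: if_cong)
    also have "\<dots> > 0" by (intro sum_pos W(2)) auto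
    finally show ?thesis .
  qed
  \<comment> \<open>Division by the trace makes the pairing with \<open>M i1\<close> equal to 1; the
    symmetric part is taken so that the Kronecker product is Hermitian.\<close>
  define V where "V = (1 / ?tr) *\<^sub>R sym_part W"
  define E where "E p = sym_part (B p)" for p
  define D :: "complex ^ ('l \<times> 'k) ^ ('l \<times> 'k)" where "D = (\<Sum>p\<in>- {i1}. kron (E p) (N p))"
  define C where "C \<nu> = kron V (mat 1) + \<nu> *\<^sub>R D" for \<nu>
  have V_pos: "0 < u \<bullet> (V *v u)" if "u \<noteq> 0" for u
    using W(2)[OF that] tr
    by (simp add: V_def inner_sym_part symmetric_rank_one flip: inner_rank_one)
  have V_M: "M p \<bullet> V = (if p = i1 then 1 else 0)" for p
    using tr W_M by (simp add: V_def inner_sym_part M_sym)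
  have E_M: "M q \<bullet> E p = (if p = q then 1 else 0)" for p q
    by (simp add: E_def inner_sym_part M_sym B)
  have contract_D: "block_contract (M p) D = (if p = i1 then 0 else N p)" for p
    by (simp add: D_def linear_sum[OF linear_block_contract] block_contract_kron E_M
        if_distrib[of "\<lambda>c. c *\<^sub>R _"] cong: if_cong)
  have contract_C: "block_contract (M p) (C \<nu>) = (if p = i1 then N p else \<nu> *\<^sub>R N p)" for p \<nu>
    by (simp add: C_def linear_add[OF linear_block_contract] linear_scale[OF linear_block_contract]
        block_contract_kron contract_D V_M N_one)
  have herm_D: "hermitian D"
    unfolding D_def E_def by (intro hermitian_sum hermitian_kron symmetric_sym_part N_herm)
  have real_C: "real_entries (C \<nu>)" if "\<forall>p. real_entries (N p)" for \<nu>
  proof -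
    have "real_entries (kron A (N p))" for A :: "real ^ 'l ^ 'l" and p
      using that by (intro real_entries_kron) blast
    \<comment> \<open>Writing \<open>mat 1\<close> as \<open>N i1\<close> brings the first summand
      under the hypothesis on the \<open>N p\<close> too.\<close>
    then show ?thesis
      unfolding C_def D_def N_one[symmetric]
      by (intro real_entries_add real_entries_scaleR real_entries_sum)
  qed
  have "hermitian (kron V (mat 1 :: complex ^ 'k ^ 'k))"
    using N_herm[of i1] unfolding V_def N_one
    by (intro hermitian_kron symmetric_scaleR symmetric_sym_part)
  then obtain r where r: "r > 0"
    "\<And>X. hermitian X \<Longrightarrow> norm X < r \<Longrightarrow> hpsd (kron V (mat 1 :: complex ^ 'k ^ 'k) + X)"
    by (rule hpsd_perturb) (use re_form_kron_mat_1_pos V_pos in auto)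

  obtain s where s: "s > 0" "ball ?e s \<subseteq> ?P"
    using axis_in_interior_hpsd_pencil[of N i1, OF N_herm N_one] by (auto simp: mem_interior)
  then have ball_s: "ball ?e s \<subseteq> interior ?P" by (simp add: interior_maximal)
  obtain R where R: "R > 0" "\<And>x. x \<in> K \<inter> H \<Longrightarrow> norm (x - ?e) \<le> R"
  proof -
    obtain R0 where R0: "\<And>x. x \<in> K \<inter> H \<Longrightarrow> norm x \<le> R0"
      using bounded by (auto simp: bounded_iff)
    have "norm (x - ?e) \<le> \<bar>R0\<bar> + 1" if "x \<in> K \<inter> H" for x
      using R0[OF that] norm_triangle_ineq4[of x ?e] by simp
    then show thesis by (intro that[of "\<bar>R0\<bar> + 1"]) auto
  qed
  \<comment> \<open>The first bound keeps \<open>\<nu> *\<^sub>R D\<close> within the perturbation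
    radius \<open>r\<close>, the second shrinks the slice into the ball of radius \<open>s\<close>.
    Adding 1 avoids division by zero, and halving makes both inequalities strict.\<close>
  define \<nu> where "\<nu> = min (r / (norm D + 1)) (s / R) / 2"
  have \<nu>_pos: "\<nu> > 0" using r(1) s(1) R(1) by (simp add: \<nu>_def add_nonneg_pos)
  have \<nu>_r: "norm (\<nu> *\<^sub>R D) < r"
  proof -
    have "\<nu> < r / (norm D + 1)"
      using \<nu>_pos unfolding \<nu>_def by linarith
    then have "\<nu> * (norm D + 1) < r" by (simp add: pos_less_divide_eq add_nonneg_pos)
    with \<nu>_pos show ?thesis by (simp add: algebra_simps)
  qed
  have \<nu>_s: "\<nu> * R < s"
  proof -
    have "\<nu> < s / R"
      using \<nu>_pos unfolding \<nu>_def by linarith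
    then show ?thesis using R(1) by (simp add: pos_less_divide_eq)
  qed
  have slice: "scale_tail i1 \<nu> x \<in> interior ?P" if x: "x \<in> K \<inter> H" for x
  proof -
    \<comment> \<open>On \<open>H\<close> the tail scaling is the homothety with centre
      \<open>?e\<close> and ratio \<nu>.\<close>
    have "scale_tail i1 \<nu> x - ?e = \<nu> *\<^sub>R (x - ?e)"
      using x by (auto simp: scale_tail_def vec_eq_iff H_def axis_def)
    then have "norm (scale_tail i1 \<nu> x - ?e) \<le> \<nu> * R"
      using R(2)[OF x] \<nu>_pos by simp
    with \<nu>_s ball_s show ?thesis by (auto simp: dist_norm norm_minus_commute)
  qed
  have cone: "scale_tail i1 \<nu> y \<in> interior ?P" if y: "y \<in> K" "y \<noteq> 0" for y
  proof -
    have pos: "y $ i1 > 0" using K_coord_pos y by blast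
    then have "(1 / y $ i1) *\<^sub>R y \<in> K \<inter> H" using K_scale y by (auto simp: H_def)
    from scaleR_interior_hpsd_pencil[OF slice[OF this] pos] pos show ?thesis
      by (simp flip: scale_tail_scaleR)
  qed
  \<comment> \<open>The slice argument reaches only nonzero vectors. The origin is no interior point
    of a set in the half-space, since a small negative multiple of \<open>?e\<close> leaves
    it.\<close>
  have zero_not_interior: "0 \<notin> interior S" if "\<And>x. x \<in> S \<Longrightarrow> 0 \<le> x $ i1" for S :: "(real ^ 'n) set"
  proof
    assume "0 \<in> interior S"
    then obtain \<epsilon> where \<epsilon>: "\<epsilon> > 0" "ball 0 \<epsilon> \<subseteq> S" by (auto simp: mem_interior)
    then have "(- (\<epsilon> / 2)) *\<^sub>R ?e \<in> S" by (intro subsetD[OF \<epsilon>(2)]) simp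
    from that[OF this] \<epsilon>(1) show False by simp
  qed
  show ?thesis
  proof (intro exI conjI)
    show "\<nu> > 0" by fact
    show "conic_stable K (complexify (poly_scale_tail i1 \<nu> f))"
    proof (rule conic_stable_poly_scale_tail)
      fix y assume y: "y \<in> interior K"
      have "0 \<le> x $ i1" if "x \<in> K" for x
        using K_coord_pos[OF that] by (cases "x = 0") auto
      then have "0 \<notin> interior K" by (rule zero_not_interior)
      with y have "y \<in> K" "y \<noteq> 0" using interior_subset by blast+
      then show "scale_tail i1 \<nu> y \<notin> imag_proj (complexify f)"
        using cone N_interior by blast
    qed
    show "hpsd (C \<nu>)"
      unfolding C_def by (intro r(2) hermitian_scaleR herm_D \<nu>_r)
    show "N i1 = (\<Sum>i\<in>UNIV. \<Sum>j\<in>UNIV. (M i1 $ i $ j) *\<^sub>R block (C \<nu>) i j)"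
      using contract_C[of i1 \<nu>] by (simp add: block_contract_def)
    show "\<forall>p. p \<noteq> i1 \<longrightarrow>
        \<nu> *\<^sub>R N p = (\<Sum>i\<in>UNIV. \<Sum>j\<in>UNIV. (M p $ i $ j) *\<^sub>R block (C \<nu>) i j)"
      using contract_C[of _ \<nu>] by (simp add: block_contract_def)
    show "(\<forall>p. real_entries (N p)) \<longrightarrow> real_entries (C \<nu>)"
      using real_C by blast
    let ?Q = "conic hull (scale_tail i1 \<nu> ` (K \<inter> H))"
    have "0 \<notin> interior ?Q"
      by (rule zero_not_interior) (auto simp: conic_hull_explicit scale_tail_def H_def)
    \<comment> \<open>Nonzero points of the hull are positive multiples of scaled slice points, and
      the interior of \<open>?P\<close> is closed under positive scaling.\<close>
    moreover have "y \<in> interior ?P" if "y \<in> ?Q" "y \<noteq> 0" for y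
    proof -
      from that(1) obtain c x where cx: "c \<ge> 0" "x \<in> K \<inter> H" "y = c *\<^sub>R scale_tail i1 \<nu> x"
        by (auto simp: conic_hull_explicit)
      with that(2) have "c > 0" by (cases "c = 0") auto
      with cx show ?thesis by (simp only: scaleR_interior_hpsd_pencil slice)
    qed
    ultimately show "conic_stable ?Q (complexify f)"
      unfolding conic_stable_iff_imag_proj using N_interior interior_subset[of ?Q] by blast
  qed
qed

end
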